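(* The generator of the Dirichlet form associated with $X$ has a spectral gap $\gamma>0$ if and only if $c_P<\infty$. In this case, $\gamma=1/c_P$.
   Context: $X=(X_t)_{t\ge 0}$ is a regular linear continuous strong Markov process with state space $\mathbb{R}$ (a one-dimensional diffusion in the sense of Revuz–Yor, Chapter VII), conservative (infinite lifetime) and positively recurrent ($\mathbb{E}_x T_y<\infty$ for all $x,y$, where $T_y=\inf\{t\ge0:X_t=y\}$). $\mathbb{P}_x,\mathbb{E}_x$ denote law and expectation when $X_0=x$. $S$ is a scale function of $X$ (continuous, strictly increasing, with $\mathbb{P}_x[T_b<T_a]=\frac{S(x)-S(a)}{S(b)-S(a)}$ for $a<x<b$), and $m$ is the speed measure associated with $S$, i.e. the Borel measure such that for $a<x<b$ and Borel $f\ge 0$, $\mathbb{E}_x\int_0^{T_a\wedge T_b}f(X_t)\,dt=\int_a^b G(a,b,x,y)f(y)\,dm(y)$, where $G(a,b,x,y)=\frac{(S(b)-S(x\vee y))(S(x\wedge y)-S(a))}{S(b)-S(a)}$. The measure $m$ charges every nonempty open set. By positive recurrence $\lim_{x\to\pm\infty}S(x)=\pm\infty$ and $m(\mathbb{R})<\infty$. $dS$ denotes the Stieltjes measure induced by $S$. For a real function $F$ on $\mathbb{R}$ write $dF\ll dS$ if there is a locally $dS$-integrable function $f$ with $\int_u^v f\,dS=F(v)-F(u)$ for all $u<v$; then $f$ is denoted $\frac{dF}{dS}$. Let $\mathcal{F}=\{F\in L^2(m):\ dF\ll dS,\ \frac{dF}{dS}\in L^2(dS)\}$. The process $X$ is $m$-symmetric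 and its Dirichlet form on $L^2(m)$ is $\mathcal{E}(F,F)=\int_{-\infty}^\infty (\frac{dF}{dS})^2 dS$ with domain $\mathcal{F}$. $c_P\in[0,\infty]$ is the infimum of the constants $c\in[0,\infty]$ such that $\int_{\mathbb{R}}(F-\overline{m}(F))^2 dm\leq c\int_{\mathbb{R}}(\frac {dF}{dS})^2 dS$ for all $F\in\mathcal{F}$, where $\overline{m}(F)=\frac{1}{m(\mathbb{R})}\int F\,dm$ ($c=\infty$ is always admissible). Spectral gap: let a Dirichlet form $\mathcal{E}$ on $L^2(m)$ be associated with the non-negative self-adjoint operator $-A$, with spectral family $(E_\xi)_{\xi\ge0}$, so $E_0$ is the orthogonal projection on $\ker A$. $-A$ has a spectral gap at $0$ of width at least $\gamma>0$ iff $\gamma\|f-E_0f\|^2_{L^2(m)}\le\mathcal{E}(f,f)$ for all $f$ in the domain of $\mathcal{E}$; the spectral gap is the largest such $\gamma$. *)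

theory Defs
  imports "HOL-Probability.Probability"
begin

section \<open>Conservative linear diffusions on the canonical path space\<close>

text \<open>A process is given by the family of its laws \<open>P x\<close> on the canonical space of
  continuous paths \<open>[0,\<infinity>) \<rightarrow> \<real>\<close>. Infinite lifetime and path continuity are thereby
  built in. As elements of a product space, the paths are \<^const>\<open>undefined\<close> off \<open>[0,\<infinity>)\<close>.\<close>

definition path_space :: "(real \<Rightarrow> real) measure" where
  "path_space = restrict_space (PiM {0..} (\<lambda>_. borel)) {\<omega>. continuous_on {0..} \<omega>}"

definition shift :: "real \<Rightarrow> (real \<Rightarrow> real) \<Rightarrow> (real \<Rightarrow> real)" where
  "shift s \<omega> = restrict (\<lambda>t. \<omega> (s + t)) {0..}"

definition natural_filtration :: "ennreal \<Rightarrow> (real \<Rightarrow> real) measure" where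
  "natural_filtration t =
     (let I = {s. 0 \<le> s \<and> ennreal s \<le> t}
      in vimage_algebra (space path_space) (\<lambda>\<omega>. restrict \<omega> I) (PiM I (\<lambda>_. borel)))"

text \<open>The filtration \<open>t \<mapsto> (\<Inter>s>t. F s)\<close>. The index \<open>\<infinity>\<close> is added to the intersection so
  that it is nonempty for \<open>t = \<infinity>\<close>; it changes nothing for finite \<open>t\<close>.\<close>

definition path_filtration :: "ennreal \<Rightarrow> (real \<Rightarrow> real) measure" where
  "path_filtration t =
     sigma (space path_space) (\<Inter>s\<in>insert \<infinity> {t<..}. sets (natural_filtration s))"

text \<open>Every stopping time of the usual augmentation of the natural filtration agrees almost
  surely with a stopping time of \<^const>\<open>path_filtration\<close>, so no completion is needed below.\<close>

definition strong_markov :: "(real \<Rightarrow> (real \<Rightarrow> real) measure) \<Rightarrow> bool" where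
  "strong_markov P \<longleftrightarrow>
     (\<forall>T. stopping_time path_filtration T \<longrightarrow>
       (\<forall>x. \<forall>A\<in>sets (filtration.pre_sigma (space path_space) path_filtration T).
         \<forall>B\<in>sets path_space.
           emeasure (P x) {\<omega>\<in>A. T \<omega> < \<infinity> \<and> shift (enn2real (T \<omega>)) \<omega> \<in> B} =
           (\<integral>\<^sup>+\<omega>\<in>{\<omega>\<in>A. T \<omega> < \<infinity>}. emeasure (P (\<omega> (enn2real (T \<omega>)))) B \<partial>P x)))"

definition hitting_time :: "real \<Rightarrow> (real \<Rightarrow> real) \<Rightarrow> ennreal" where
  "hitting_time y \<omega> = Inf {ennreal t |t. 0 \<le> t \<and> \<omega> t = y}"

definition regular :: "(real \<Rightarrow> (real \<Rightarrow> real) measure) \<Rightarrow> bool" where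
  "regular P \<longleftrightarrow> (\<forall>x y. emeasure (P x) {\<omega>\<in>space path_space. hitting_time y \<omega> < \<infinity>} > 0)"

definition diffusion :: "(real \<Rightarrow> (real \<Rightarrow> real) measure) \<Rightarrow> bool" where
  "diffusion P \<longleftrightarrow>
     P \<in> borel \<rightarrow>\<^sub>M prob_algebra path_space \<and>
     (\<forall>x. AE \<omega> in P x. \<omega> 0 = x) \<and>
     strong_markov P \<and> regular P"

definition positively_recurrent :: "(real \<Rightarrow> (real \<Rightarrow> real) measure) \<Rightarrow> bool" where
  "positively_recurrent P \<longleftrightarrow> (\<forall>x y. (\<integral>\<^sup>+\<omega>. hitting_time y \<omega> \<partial>P x) < \<infinity>)"

definition scale_function :: "(real \<Rightarrow> (real \<Rightarrow> real) measure) \<Rightarrow> (real \<Rightarrow> real) \<Rightarrow> bool" where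
  "scale_function P S \<longleftrightarrow>
     continuous_on UNIV S \<and> strict_mono S \<and>
     (\<forall>a x b. a < x \<and> x < b \<longrightarrow>
        measure (P x) {\<omega>\<in>space path_space. hitting_time b \<omega> < hitting_time a \<omega>} =
          (S x - S a) / (S b - S a))"

definition green_kernel :: "(real \<Rightarrow> real) \<Rightarrow> real \<Rightarrow> real \<Rightarrow> real \<Rightarrow> real \<Rightarrow> real" where
  "green_kernel S a b x y = (S b - S (max x y)) * (S (min x y) - S a) / (S b - S a)"

definition speed_measure ::
  "(real \<Rightarrow> (real \<Rightarrow> real) measure) \<Rightarrow> (real \<Rightarrow> real) \<Rightarrow> real measure \<Rightarrow> bool" where
  "speed_measure P S m \<longleftrightarrow>
     sets m = sets borel \<and>
     (\<forall>a x b. a < x \<and> x < b \<longrightarrow> (\<forall>f :: real \<Rightarrow> ennreal. f \<in> borel_measurable borel \<longrightarrow>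
        (\<integral>\<^sup>+\<omega>. (\<integral>\<^sup>+t\<in>{t. 0 \<le> t \<and> ennreal t < min (hitting_time a \<omega>) (hitting_time b \<omega>)}.
                   f (\<omega> t) \<partial>lborel) \<partial>P x) =
        (\<integral>\<^sup>+y\<in>{a<..<b}. ennreal (green_kernel S a b x y) * f y \<partial>m)))"


section \<open>The Dirichlet form\<close>

definition square_integrable :: "'a measure \<Rightarrow> ('a \<Rightarrow> real) set" where
  "square_integrable M = {f \<in> borel_measurable M. integrable M (\<lambda>x. (f x)\<^sup>2)}"

definition has_scale_density :: "(real \<Rightarrow> real) \<Rightarrow> (real \<Rightarrow> real) \<Rightarrow> (real \<Rightarrow> real) \<Rightarrow> bool" where
  "has_scale_density S F f \<longleftrightarrow>
     (\<forall>u v. u < v \<longrightarrow>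
        set_integrable (interval_measure S) {u..v} f \<and>
        (LINT x:{u..v}|interval_measure S. f x) = F v - F u)"

text \<open>\<open>dF/dS\<close>; determined up to \<open>dS\<close>-null sets if it exists.\<close>

definition scale_deriv :: "(real \<Rightarrow> real) \<Rightarrow> (real \<Rightarrow> real) \<Rightarrow> (real \<Rightarrow> real)" where
  "scale_deriv S F = (SOME f. has_scale_density S F f)"

text \<open>The elements of the form domain are functions, not classes. As the speed measure charges
  every nonempty open set and \<open>dF \<lless> dS\<close> forces \<open>F\<close> to be continuous, each class in \<open>L\<^sup>2(m)\<close>
  contains at most one of them.\<close>

definition form_domain :: "(real \<Rightarrow> real) \<Rightarrow> real measure \<Rightarrow> (real \<Rightarrow> real) set" where
  "form_domain S m =
     {F \<in> square_integrable m. (\<exists>f. has_scale_density S F f) \<and>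
        scale_deriv S F \<in> square_integrable (interval_measure S)}"

definition dirichlet_form :: "(real \<Rightarrow> real) \<Rightarrow> (real \<Rightarrow> real) \<Rightarrow> (real \<Rightarrow> real) \<Rightarrow> real" where
  "dirichlet_form S F G = (LINT x|interval_measure S. scale_deriv S F x * scale_deriv S G x)"


section \<open>Generator and spectral gap\<close>

text \<open>The graph of the operator \<open>A\<close> on \<open>L\<^sup>2(M)\<close> associated with the form \<open>E\<close> with domain \<open>D\<close>:
  \<open>E(f,h) = \<langle>-A f, h\<rangle>\<close> for all \<open>h \<in> D\<close>. It contains every \<open>M\<close>-version of \<open>A f\<close>.\<close>

definition form_generator ::
  "'a measure \<Rightarrow> ('a \<Rightarrow> real) set \<Rightarrow> (('a \<Rightarrow> real) \<Rightarrow> ('a \<Rightarrow> real) \<Rightarrow> real) \<Rightarrow>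
   (('a \<Rightarrow> real) \<times> ('a \<Rightarrow> real)) set" where
  "form_generator M D E =
     {(f, g). f \<in> D \<and> g \<in> square_integrable M \<and>
        (\<forall>h\<in>D. E f h = (LINT x|M. (- g x) * h x))}"

definition operator_kernel :: "(('a \<Rightarrow> real) \<times> ('a \<Rightarrow> real)) set \<Rightarrow> ('a \<Rightarrow> real) set" where
  "operator_kernel A = {f. (f, (\<lambda>_. 0)) \<in> A}"

definition orth_proj :: "'a measure \<Rightarrow> ('a \<Rightarrow> real) set \<Rightarrow> ('a \<Rightarrow> real) \<Rightarrow> ('a \<Rightarrow> real)" where
  "orth_proj M K f = (SOME p. p \<in> K \<and> (\<forall>k\<in>K. (LINT x|M. (f x - p x) * k x) = 0))"

definition spectral_gap_at_least ::
  "'a measure \<Rightarrow> ('a \<Rightarrow> real) set \<Rightarrow> (('a \<Rightarrow> real) \<Rightarrow> ('a \<Rightarrow> real) \<Rightarrow> real) \<Rightarrow> real \<Rightarrow> bool" where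
  "spectral_gap_at_least M D E \<gamma> \<longleftrightarrow> \<gamma> > 0 \<and>
     (\<forall>f\<in>D. \<gamma> * (LINT x|M. (f x - orth_proj M (operator_kernel (form_generator M D E)) f x)\<^sup>2)
              \<le> E f f)"

definition is_spectral_gap ::
  "'a measure \<Rightarrow> ('a \<Rightarrow> real) set \<Rightarrow> (('a \<Rightarrow> real) \<Rightarrow> ('a \<Rightarrow> real) \<Rightarrow> real) \<Rightarrow> real \<Rightarrow> bool" where
  "is_spectral_gap M D E \<gamma> \<longleftrightarrow>
     spectral_gap_at_least M D E \<gamma> \<and> (\<forall>\<gamma>'. spectral_gap_at_least M D E \<gamma>' \<longrightarrow> \<gamma>' \<le> \<gamma>)"


section \<open>The Poincar\'e constant\<close>

definition mean :: "'a measure \<Rightarrow> ('a \<Rightarrow> real) \<Rightarrow> real" where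
  "mean M F = (LINT x|M. F x) / measure M (space M)"

text \<open>In \<^typ>\<open>ennreal\<close>, \<open>\<infinity> * 0 = 0\<close>; whether \<open>c = \<infinity>\<close> belongs to the set is immaterial, as it
  does not affect the infimum.\<close>

definition poincare_const :: "(real \<Rightarrow> real) \<Rightarrow> real measure \<Rightarrow> ennreal" where
  "poincare_const S m =
     Inf {c. \<forall>F\<in>form_domain S m.
       (\<integral>\<^sup>+x. ennreal ((F x - mean m F)\<^sup>2) \<partial>m) \<le>
         c * (\<integral>\<^sup>+x. ennreal ((scale_deriv S F x)\<^sup>2) \<partial>interval_measure S)}"

end

theory Submission
  imports Defs "HOL-Real_Asymp.Real_Asymp"
begin

text \<open>If the scale function were bounded above (below), a path starting at \<open>0\<close> would, with
  probability bounded away from \<open>0\<close>, reach arbitrarily large (small) values before \<open>-1\<close> (before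
  \<open>1\<close>); by continuity it would then never hit \<open>-1\<close> (\<open>1\<close>), against positive recurrence. As the
  scale function is unbounded, the Green kernel on \<open>(-1, b)\<close> with \<open>b \<rightarrow> \<infinity>\<close> bounds
  \<open>m([0, \<infinity>))\<close> by a multiple of the expectation of the hitting time of \<open>-1\<close> from \<open>0\<close>, and
  symmetrically on the other side, so \<open>m\<close> is finite. Hence constants lie in the form domain,
  they make up the kernel of the generator because the form vanishes only on constants, and the
  projection onto them is the mean. The spectral gap inequality with constant \<open>\<gamma>\<close> is therefore
  the Poincar\'e inequality with constant \<open>1 / \<gamma>\<close>. Exit times from intervals are
  positive, so \<open>m\<close> charges intervals; a clamped scale function then has
  positive variance, so the Poincar\'e constant is not \<open>0\<close>.\<close>

section \<open>Finiteness and support of the speed measure\<close>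

text \<open>A finite hitting time of \<open>b\<close> would confine the path up to shortly after it
  to a compact set, whereas some \<open>c n\<close> outside that set is visited by then.\<close>

lemma hitting_time_eq_top:
  assumes "continuous_on {0..} \<omega>"
    and c: "filterlim (\<lambda>n. \<bar>c n\<bar>) at_top sequentially"
    and freq: "\<exists>\<^sub>F n in sequentially. hitting_time (c n) \<omega> \<le> hitting_time b \<omega>"
  shows "hitting_time b \<omega> = \<infinity>"
proof (rule ccontr)
  assume "hitting_time b \<omega> \<noteq> \<infinity>"
  then obtain r where r: "0 \<le> r" "hitting_time b \<omega> = ennreal r"
    by (cases "hitting_time b \<omega>") auto
  have "compact (\<omega> ` {0..r + 1})"
    by (rule compact_continuous_image[OF continuous_on_subset[OF assms(1)]]) auto
  then obtain B where B: "\<And>t. 0 \<le> t \<Longrightarrow> t \<le> r + 1 \<Longrightarrow> \<bar>\<omega> t\<bar> \<le> B"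
    by (force dest!: compact_imp_bounded simp: bounded_real)
  have "\<forall>\<^sub>F n in sequentially. \<bar>c n\<bar> > B"
    using c by (simp add: filterlim_at_top_dense)
  then obtain n where n: "hitting_time (c n) \<omega> \<le> hitting_time b \<omega>" "\<bar>c n\<bar> > B"
    using freq frequently_ex[OF frequently_eventually_frequently] by blast
  \<comment> \<open>The hitting time is an infimum; the extra unit of time turns its bound into an
    actual visit before \<open>r + 1\<close>, within the range bounded by \<open>B\<close>.\<close>
  have "hitting_time (c n) \<omega> < ennreal (r + 1)"
    using n(1) r by (metis ennreal_lessI le_less_trans less_add_one add_nonneg_pos zero_less_one)
  then obtain t where "0 \<le> t" "\<omega> t = c n" "ennreal t < ennreal (r + 1)"
    unfolding hitting_time_def Inf_less_iff by blast
  then show False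
    using B[of t] n(2) by (simp add: ennreal_less_iff del: ennreal_plus)
qed

text \<open>The limit superior \<open>N\<close> of the events has measure at least \<open>p\<close>
  by continuity from above, and \<open>T\<close> is infinite on \<open>N\<close>.\<close>

lemma (in finite_measure) nn_integral_eq_top_if_frequently:
  assumes A: "\<And>n::nat. A n \<in> sets M" and p: "0 < p" "\<And>n. p \<le> measure M (A n)"
    and top: "\<And>x. x \<in> space M \<Longrightarrow> \<exists>\<^sub>F n in sequentially. x \<in> A n \<Longrightarrow> T x = \<infinity>"
  shows "(\<integral>\<^sup>+x. T x \<partial>M) = \<infinity>"
proof -
  define N where "N = (\<Inter>k. \<Union>n\<in>{k..}. A n)"
  have N: "N \<in> sets M"
    using A by (auto simp: N_def)
  have "(\<lambda>k. measure M (\<Union>n\<in>{k..}. A n)) \<longlonglongrightarrow> measure M N"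
    unfolding N_def using A
    by (intro finite_Lim_measure_decseq) (auto simp: decseq_def intro: order_trans)
  moreover have "p \<le> measure M (\<Union>n\<in>{k..}. A n)" for k
    using A by (intro order_trans[OF p(2)[of k] finite_measure_mono]) auto
  ultimately have "p \<le> measure M N"
    by (meson LIMSEQ_le_const)
  then have "emeasure M N > 0"
    using p(1) by (simp add: emeasure_eq_measure)
  then have "\<infinity> = (\<integral>\<^sup>+x. \<infinity> * indicator N x \<partial>M)"
    using N by (subst nn_integral_cmult_indicator) (auto simp: ennreal_top_mult)
  also have "\<dots> \<le> (\<integral>\<^sup>+x. T x \<partial>M)"
    using top by (intro nn_integral_mono)
      (auto simp: N_def frequently_sequentially Bex_def split: split_indicator)
  finally show ?thesis
    by (simp add: top_unique)
qed

text \<open>With the test function 1, this turns the occupation formula that defines the speed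
  measure into a formula for expected exit times, infinite ones included.\<close>

lemma nn_integral_time_before:
  "(\<integral>\<^sup>+t\<in>{t. 0 \<le> t \<and> ennreal t < \<tau>}. 1 \<partial>lborel) = \<tau>"
proof (cases \<tau>)
  case (real r)
  then have "{t. 0 \<le> t \<and> ennreal t < \<tau>} = {0..<r}"
    by (auto simp: ennreal_less_iff)
  with real show ?thesis by simp
next
  case top
  then have "{t. 0 \<le> t \<and> ennreal t < \<tau>} = {0..}"
    by auto
  moreover have "emeasure lborel {0::real..} = \<infinity>"
  proof (rule ccontr)
    assume "\<not> ?thesis"
    then obtain r where r: "0 \<le> r" "emeasure lborel {0::real..} = ennreal r"
      by (cases "emeasure lborel {0::real..}") auto
    have "emeasure lborel {0..r + 1} \<le> emeasure lborel {0::real..}"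
      by (intro emeasure_mono) auto
    then show False
      using r by (simp del: ennreal_plus)
  qed
  ultimately show ?thesis
    using top by simp
qed

lemma path_continuous: "\<omega> \<in> space path_space \<Longrightarrow> continuous_on {0..} \<omega>"
  by (simp add: path_space_def space_restrict_space)

lemma measurable_path_eval:
  assumes "0 \<le> t"
  shows "(\<lambda>\<omega>. \<omega> t) \<in> borel_measurable path_space"
  unfolding path_space_def
  using assms by (intro measurable_restrict_space1 measurable_component_singleton) auto

lemma diffusionD:
  assumes "diffusion P"
  shows "prob_space (P x)" "sets (P x) = sets path_space" "space (P x) = space path_space"
    "AE \<omega> in P x. \<omega> 0 = x"
proof -
  have "P x \<in> space (prob_algebra path_space)"
    using assms measurable_space[of P borel "prob_algebra path_space" x]
    by (simp add: diffusion_def)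
  then show "prob_space (P x)" and sets: "sets (P x) = sets path_space"
    by (simp_all add: space_prob_algebra)
  from sets show "space (P x) = space path_space"
    by (rule sets_eq_imp_space_eq)
  show "AE \<omega> in P x. \<omega> 0 = x"
    using assms by (simp add: diffusion_def)
qed

text \<open>No measurability of hitting times is needed: a set of positive \<^const>\<open>measure\<close> is
  measurable, since \<^const>\<open>measure\<close> vanishes off the \<open>\<sigma>\<close>-algebra.\<close>

lemma scale_function_hitting_event:
  assumes "diffusion P" "scale_function P S" "a < x" "x < b"
  defines "A \<equiv> {\<omega>\<in>space path_space. hitting_time b \<omega> < hitting_time a \<omega>}"
  shows "A \<in> sets (P x)" "measure (P x) A = (S x - S a) / (S b - S a)"
proof -
  show eq: "measure (P x) A = (S x - S a) / (S b - S a)"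
    using assms by (auto simp: scale_function_def)
  have "S a < S x" "S x < S b"
    using assms by (auto simp: scale_function_def strict_mono_def)
  then have "measure (P x) A \<noteq> 0"
    unfolding eq by simp
  then show "A \<in> sets (P x)"
    using measure_notin_sets by blast
qed

section \<open>Unboundedness of the scale function\<close>

lemma scale_function_unbounded_above:
  assumes "diffusion P" "positively_recurrent P" "scale_function P S"
  obtains b where "S b > K"
proof (rule ccontr)
  assume "\<not> thesis"
  with that have K: "S b \<le> K" for b
    by (meson not_le)
  interpret prob_space "P 0" by (rule diffusionD[OF assms(1)])
  have mono: "strict_mono S"
    using assms(3) by (simp add: scale_function_def)
  let ?A = "\<lambda>n. {\<omega>\<in>space path_space. hitting_time (real (Suc n)) \<omega> < hitting_time (-1) \<omega>}"
  note A = scale_function_hitting_event[OF assms(1,3), of "-1" 0]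
  have S: "S (-1) < S 0" "S 0 < S (real (Suc n))" for n
    using mono by (auto simp: strict_mono_def)
  have "(\<integral>\<^sup>+\<omega>. hitting_time (-1) \<omega> \<partial>P 0) = \<infinity>"
  proof (rule nn_integral_eq_top_if_frequently[where A = ?A])
    show "?A n \<in> events" for n
      using A(1)[of "real (Suc n)"] by simp
    \<comment> \<open>Replacing \<open>S\<close> at the upper endpoint by its supposed bound
      \<open>K\<close> makes the hitting probability bound uniform in \<open>n\<close>.\<close>
    show "0 < (S 0 - S (-1)) / (K - S (-1))"
      using S(1) K[of 0] by (intro divide_pos_pos) linarith+
    show "(S 0 - S (-1)) / (K - S (-1)) \<le> prob (?A n)" for n
      using A(2)[of "real (Suc n)"] S(1) S(2)[of n] K[of "real (Suc n)"]
      by (auto intro!: divide_left_mono)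
    fix \<omega> assume "\<omega> \<in> space (P 0)" and freq: "\<exists>\<^sub>F n in sequentially. \<omega> \<in> ?A n"
    then have "continuous_on {0..} \<omega>"
      by (simp add: diffusionD[OF assms(1)] path_continuous)
    moreover have "filterlim (\<lambda>n. \<bar>real (Suc n)\<bar>) at_top sequentially"
      by real_asymp
    moreover have "\<exists>\<^sub>F n in sequentially. hitting_time (real (Suc n)) \<omega> \<le> hitting_time (-1) \<omega>"
      using freq by (rule frequently_elim1) auto
    ultimately show "hitting_time (-1) \<omega> = \<infinity>"
      by (rule hitting_time_eq_top)
  qed
  then show False
    using assms(2) by (metis less_irrefl positively_recurrent_def)
qed

lemma scale_function_unbounded_below:
  assumes "diffusion P" "positively_recurrent P" "scale_function P S"
  obtains a where "S a < K"
proof (rule ccontr)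
  assume "\<not> thesis"
  with that have K: "K \<le> S a" for a
    by (meson not_le)
  interpret prob_space "P 0" by (rule diffusionD[OF assms(1)])
  have mono: "strict_mono S"
    using assms(3) by (simp add: scale_function_def)
  let ?A = "\<lambda>n. {\<omega>\<in>space path_space. hitting_time 1 \<omega> < hitting_time (- real (Suc n)) \<omega>}"
  note A = scale_function_hitting_event[OF assms(1,3), of _ 0 1]
  have S: "S (- real (Suc n)) < S 0" "S 0 < S 1" for n
    using mono by (auto simp: strict_mono_def)
  have "(\<integral>\<^sup>+\<omega>. hitting_time 1 \<omega> \<partial>P 0) = \<infinity>"
  \<comment> \<open>The scale function gives the probability of reaching the upper point first, so
    the complement is taken. It also contains the paths that reach neither point, which is harmless
    because \<open>hitting_time_eq_top\<close> asks only for a weak inequality.\<close>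
  proof (rule nn_integral_eq_top_if_frequently[where A = "\<lambda>n. space (P 0) - ?A n"])
    show "space (P 0) - ?A n \<in> events" for n
      using A(1)[of "- real (Suc n)"] by (intro sets.compl_sets) simp
    show "0 < (S 1 - S 0) / (S 1 - K)"
      using S(2) K[of 0] by (intro divide_pos_pos) linarith+
    show "(S 1 - S 0) / (S 1 - K) \<le> prob (space (P 0) - ?A n)" for n
    proof -
      have "prob (space (P 0) - ?A n) = 1 - (S 0 - S (- real (Suc n))) / (S 1 - S (- real (Suc n)))"
        using A[of "- real (Suc n)"] by (subst prob_compl) simp_all
      also have "\<dots> = (S 1 - S 0) / (S 1 - S (- real (Suc n)))"
        using S(1)[of n] S(2) by (simp add: field_simps)
      also have "\<dots> \<ge> (S 1 - S 0) / (S 1 - K)"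
        using S(1)[of n] S(2) K[of "- real (Suc n)"]
        by (intro divide_left_mono mult_pos_pos) linarith+
      finally show ?thesis .
    qed
    fix \<omega> assume \<omega>: "\<omega> \<in> space (P 0)"
      and freq: "\<exists>\<^sub>F n in sequentially. \<omega> \<in> space (P 0) - ?A n"
    then have "continuous_on {0..} \<omega>"
      by (simp add: diffusionD[OF assms(1)] path_continuous)
    moreover have "filterlim (\<lambda>n. \<bar>- real (Suc n)\<bar>) at_top sequentially"
      by real_asymp
    moreover have "\<exists>\<^sub>F n in sequentially. hitting_time (- real (Suc n)) \<omega> \<le> hitting_time 1 \<omega>"
      using freq by (rule frequently_elim1) (auto simp: diffusionD[OF assms(1)])
    ultimately show "hitting_time 1 \<omega> = \<infinity>"
      by (rule hitting_time_eq_top)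
  qed
  then show False
    using assms(2) by (metis less_irrefl positively_recurrent_def)
qed

section \<open>Exit times and the support of the speed measure\<close>

lemma nn_integral_exit_time:
  assumes "speed_measure P S m" "a < x" "x < b"
  shows "(\<integral>\<^sup>+\<omega>. min (hitting_time a \<omega>) (hitting_time b \<omega>) \<partial>P x) =
    (\<integral>\<^sup>+y\<in>{a<..<b}. ennreal (green_kernel S a b x y) \<partial>m)"
proof -
  have "(\<integral>\<^sup>+\<omega>. (\<integral>\<^sup>+t\<in>{t. 0 \<le> t \<and> ennreal t < min (hitting_time a \<omega>) (hitting_time b \<omega>)}.
                   (\<lambda>_. 1) (\<omega> t) \<partial>lborel) \<partial>P x) =
        (\<integral>\<^sup>+y\<in>{a<..<b}. ennreal (green_kernel S a b x y) * (\<lambda>_. 1) y \<partial>m)"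
    using assms unfolding speed_measure_def by (blast intro: borel_measurable_const)
  then show ?thesis
    by (simp only: nn_integral_time_before mult_1_right)
qed

text \<open>By continuity at time 0 almost every path lies in some \<open>B k\<close>. One of these
  countably many events thus has positive probability, and on it the exit takes at least a fixed
  positive time.\<close>

lemma exit_time_pos:
  assumes "diffusion P" "a < x" "x < b"
  shows "(\<integral>\<^sup>+\<omega>. min (hitting_time a \<omega>) (hitting_time b \<omega>) \<partial>P x) > 0"
proof -
  interpret prob_space "P x" by (rule diffusionD[OF assms(1)])
  note [measurable_cong] = diffusionD(2)[OF assms(1), of x]
  \<comment> \<open>Half the distance to the nearer endpoint puts both endpoints strictly outside
    the closed \<open>d\<close>-neighbourhood of \<open>x\<close>.\<close>
  define d where "d = min (x - a) (b - x) / 2"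
  have d: "0 < d" "d < x - a" "d < b - x"
    using assms by (auto simp: d_def)
  \<comment> \<open>Restricting to rational times makes \<open>B k\<close> a countable intersection
    of measurable sets; continuity later extends the control to all times.\<close>
  define B where "B k = {\<omega>\<in>space (P x). \<forall>q\<in>\<rat> \<inter> {0..inverse (real (Suc k))}. \<bar>\<omega> q - x\<bar> \<le> d}"
    for k
  have B: "B k \<in> events" for k
  proof -
    have "{\<omega>\<in>space (P x). \<bar>\<omega> q - x\<bar> \<le> d} \<in> events" if "0 \<le> q" for q
    proof -
      have [measurable]: "(\<lambda>\<omega>. \<omega> q) \<in> borel_measurable (P x)"
        using measurable_path_eval[OF that]
        by (simp cong: measurable_cong_sets add: diffusionD(2)[OF assms(1)])
      show ?thesis by measurable
    qed
    then show ?thesis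
      unfolding B_def
      by (intro sets.sets_Collect_countable_All' countable_Int1 countable_rat) simp
  qed
  have ex: "AE \<omega> in P x. \<exists>k. \<omega> \<in> B k"
    using diffusionD(4)[OF assms(1), of x] AE_space
  proof eventually_elim
    case (elim \<omega>)
    then have "continuous_on {0..} \<omega>"
      by (simp add: diffusionD[OF assms(1)] path_continuous)
    then obtain e where e: "e > 0" "\<And>t. 0 \<le> t \<Longrightarrow> t < e \<Longrightarrow> \<bar>\<omega> t - x\<bar> < d"
      using d(1) elim(1) unfolding continuous_on_iff
      by (force simp: dist_real_def dest: bspec[of _ _ 0])
    obtain k where "inverse (real (Suc k)) < e"
      using reals_Archimedean[OF e(1)] by auto
    then have "\<omega> \<in> B k"
      using e(2) elim(2) by (auto simp: B_def intro: less_imp_le)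
    then show ?case ..
  qed
  have "\<not> (AE \<omega> in P x. \<forall>k. \<omega> \<notin> B k)"
  proof
    assume "AE \<omega> in P x. \<forall>k. \<omega> \<notin> B k"
    with ex have "AE \<omega> in P x. False"
      by eventually_elim blast
    then show False
      by (simp only: AE_False)
  qed
  then have "\<not> (\<forall>k. AE \<omega> in P x. \<omega> \<notin> B k)"
    unfolding AE_all_countable .
  then obtain k where "\<not> (AE \<omega> in P x. \<omega> \<notin> B k)"
    by auto
  then have pos: "emeasure (P x) (B k) > 0"
    using AE_iff_measurable[OF B[of k], of "\<lambda>\<omega>. \<omega> \<notin> B k"]
    by (auto simp: zero_less_iff_neq_zero B_def cong: conj_cong)
  define \<epsilon> where "\<epsilon> = inverse (real (Suc k))"
  have \<epsilon>: "\<epsilon> > 0" by (simp add: \<epsilon>_def)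
  have hit: "ennreal \<epsilon> \<le> hitting_time c \<omega>" if "\<omega> \<in> B k" and c: "\<bar>c - x\<bar> > d" for \<omega> c
    unfolding hitting_time_def
  proof (rule Inf_greatest, clarify)
    fix t assume t: "0 \<le> t" "c = \<omega> t"
    have cont: "continuous_on {0..} \<omega>"
      using that by (simp add: B_def diffusionD[OF assms(1)] path_continuous)
    show "ennreal \<epsilon> \<le> ennreal t"
    proof (rule ccontr)
      assume "\<not> ?thesis"
      then have "t < \<epsilon>" using t \<epsilon> by (simp add: not_le ennreal_less_iff)
      obtain e where e: "e > 0" "\<And>s. 0 \<le> s \<Longrightarrow> \<bar>s - t\<bar> < e \<Longrightarrow> \<bar>\<omega> s - \<omega> t\<bar> < \<bar>c - x\<bar> - d"
        using cont t c unfolding continuous_on_iff dist_real_def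
        by (metis atLeast_iff diff_gt_0_iff_gt)
      \<comment> \<open>At a rational time just after \<open>t\<close> the path is still close to
        \<open>c\<close>, hence farther than \<open>d\<close> from \<open>x\<close>, against
        membership in \<open>B k\<close>.\<close>
      obtain q where q: "q \<in> \<rat>" "t < q" "q < min \<epsilon> (t + e)"
        using Rats_dense_in_real[of t "min \<epsilon> (t + e)"] e(1) \<open>t < \<epsilon>\<close> by auto
      have "\<bar>\<omega> q - x\<bar> \<le> d"
        using that(1) q t(1) by (auto simp: B_def \<epsilon>_def)
      moreover have "\<bar>\<omega> q - \<omega> t\<bar> < \<bar>c - x\<bar> - d"
        using q t(1) by (intro e) auto
      ultimately show False
        using t(2) by linarith
    qed
  qed
  have "0 < ennreal \<epsilon> * emeasure (P x) (B k)"
    using pos \<epsilon> by (simp add: ennreal_zero_less_mult_iff)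
  also have "\<dots> = (\<integral>\<^sup>+\<omega>. ennreal \<epsilon> * indicator (B k) \<omega> \<partial>P x)"
    using B by (simp add: nn_integral_cmult_indicator)
  also have "\<dots> \<le> (\<integral>\<^sup>+\<omega>. min (hitting_time a \<omega>) (hitting_time b \<omega>) \<partial>P x)"
    using d hit by (intro nn_integral_mono) (auto split: split_indicator)
  finally show ?thesis .
qed

text \<open>On a null interval the Green integral would vanish, but it equals the expected exit time
  from the midpoint, which is positive.\<close>

lemma speed_measure_interval_pos:
  assumes "diffusion P" "speed_measure P S m" "a < b"
  shows "emeasure m {a<..<b} > 0"
proof (rule ccontr)
  assume "\<not> ?thesis"
  then have "{a<..<b} \<in> null_sets m"
    using assms(2) by (auto simp: speed_measure_def null_sets_def)
  then have "AE y in m. y \<notin> {a<..<b}"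
    by (rule AE_not_in)
  then have "(\<integral>\<^sup>+y\<in>{a<..<b}. ennreal (green_kernel S a b ((a + b) / 2) y) \<partial>m) = 0"
    by (intro nn_integral_zero' ) (auto elim!: eventually_mono)
  then show False
    using exit_time_pos[OF assms(1), of a "(a + b) / 2" b] assms(3)
      nn_integral_exit_time[OF assms(2), of a "(a + b) / 2" b] by simp
qed

section \<open>Finiteness of the speed measure\<close>

lemma speed_measure_finite_above:
  assumes "diffusion P" "positively_recurrent P" "scale_function P S" "speed_measure P S m"
  shows "emeasure m {0..} < \<infinity>"
proof -
  have mono: "strict_mono S"
    using assms(3) by (simp add: scale_function_def)
  have sets: "sets m = sets borel"
    using assms(4) by (simp add: speed_measure_def)
  define I where "I = (\<integral>\<^sup>+\<omega>. hitting_time (-1) \<omega> \<partial>P 0)"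
  define d where "d = (S 0 - S (-1)) / 2"
  have d: "0 < d"
    using mono by (simp add: d_def strict_mono_def)
  have bound: "ennreal d * emeasure m {0..real n} \<le> I" for n
  proof -
    \<comment> \<open>This threshold makes \<open>(S b - S y) / (S b - S (-1))\<close> at least 1/2
      for all \<open>y\<close> up to \<open>n\<close>; hence the factor 1/2 in \<open>d\<close>,
      which does not depend on \<open>n\<close>.\<close>
    obtain b where b: "S b > 2 * S n - S (-1)"
      by (rule scale_function_unbounded_above[OF assms(1-3)])
    have "S (-1) < S (real n)"
      using mono by (simp add: strict_mono_def)
    with b have "S n < S b" by linarith
    then have "real n < b"
      using mono by (simp add: strict_mono_less)
    have kernel: "d \<le> green_kernel S (-1) b 0 y" if "0 \<le> y" "y \<le> real n" for y
    proof -
      have "S y \<le> S n" "S 0 \<le> S y" "S (-1) < S 0" "S n < S b"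
        using mono that \<open>real n < b\<close> by (auto simp: strict_mono_less_eq strict_mono_less)
      moreover have "(S 0 - S (-1)) * (S b - S (-1)) \<le> (S 0 - S (-1)) * (2 * (S b - S y))"
        using calculation b by (intro mult_left_mono; argo)
      ultimately show ?thesis
        using that by (simp add: green_kernel_def d_def field_simps)
    qed
    have "ennreal d * emeasure m {0..real n} = (\<integral>\<^sup>+y. ennreal d * indicator {0..real n} y \<partial>m)"
      by (simp add: nn_integral_cmult_indicator sets)
    also have "\<dots> \<le> (\<integral>\<^sup>+y\<in>{-1<..<b}. ennreal (green_kernel S (-1) b 0 y) \<partial>m)"
      using kernel \<open>real n < b\<close>
      by (intro nn_integral_mono) (auto split: split_indicator intro: ennreal_leI)
    \<comment> \<open>The exit time from the interval is at most the hitting time of its lower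
      endpoint.\<close>
    also have "\<dots> \<le> I"
      unfolding I_def using \<open>real n < b\<close>
      by (subst nn_integral_exit_time[OF assms(4), symmetric]) (auto intro!: nn_integral_mono)
    finally show ?thesis .
  qed
  have "(\<Union>n. {0..real n}) = {0..}"
    using real_arch_simple by auto
  then have "emeasure m {0..} = (SUP n. emeasure m {0..real n})"
    by (subst SUP_emeasure_incseq) (auto simp: sets incseq_def)
  then have "ennreal d * emeasure m {0..} \<le> I"
    using bound by (simp add: SUP_mult_left_ennreal SUP_least)
  moreover have "I < \<infinity>"
    using assms(2) by (simp add: I_def positively_recurrent_def)
  ultimately have "ennreal d * emeasure m {0..} < \<infinity>"
    by (rule le_less_trans)
  then show ?thesis
    using d by (auto simp: ennreal_mult_less_top)
qed

lemma speed_measure_finite_below: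
  assumes "diffusion P" "positively_recurrent P" "scale_function P S" "speed_measure P S m"
  shows "emeasure m {..0} < \<infinity>"
proof -
  have mono: "strict_mono S"
    using assms(3) by (simp add: scale_function_def)
  have sets: "sets m = sets borel"
    using assms(4) by (simp add: speed_measure_def)
  define I where "I = (\<integral>\<^sup>+\<omega>. hitting_time 1 \<omega> \<partial>P 0)"
  define d where "d = (S 1 - S 0) / 2"
  have d: "0 < d"
    using mono by (simp add: d_def strict_mono_def)
  have bound: "ennreal d * emeasure m {- real n..0} \<le> I" for n
  proof -
    \<comment> \<open>Mirror image of the upper half: \<open>(S y - S a) / (S 1 - S a)\<close> is at
      least 1/2 for \<open>y\<close> between \<open>- n\<close> and 0.\<close>
    obtain a where a: "S a < 2 * S (- real n) - S 1"
      by (rule scale_function_unbounded_below[OF assms(1-3)])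
    have "S (- real n) < S 1"
      using mono by (simp add: strict_mono_def)
    with a have "S a < S (- real n)" by linarith
    then have "a < - real n"
      using mono by (simp add: strict_mono_less)
    have kernel: "d \<le> green_kernel S a 1 0 y" if "- real n \<le> y" "y \<le> 0" for y
    proof -
      have "S (- real n) \<le> S y" "S y \<le> S 0" "S 0 < S 1" "S a < S (- real n)"
        using mono that \<open>a < - real n\<close> by (auto simp: strict_mono_less_eq strict_mono_less)
      moreover have "(S 1 - S 0) * (S 1 - S a) \<le> (S 1 - S 0) * (2 * (S y - S a))"
        using calculation a by (intro mult_left_mono; argo)
      ultimately show ?thesis
        using that by (simp add: green_kernel_def d_def field_simps)
    qed
    have "ennreal d * emeasure m {- real n..0} = (\<integral>\<^sup>+y. ennreal d * indicator {- real n..0} y \<partial>m)"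
      by (simp add: nn_integral_cmult_indicator sets)
    also have "\<dots> \<le> (\<integral>\<^sup>+y\<in>{a<..<1}. ennreal (green_kernel S a 1 0 y) \<partial>m)"
      using kernel \<open>a < - real n\<close>
      by (intro nn_integral_mono) (auto split: split_indicator intro: ennreal_leI)
    also have "\<dots> \<le> I"
      unfolding I_def using \<open>a < - real n\<close>
      by (subst nn_integral_exit_time[OF assms(4), symmetric]) (auto intro!: nn_integral_mono)
    finally show ?thesis .
  qed
  have "x \<in> (\<Union>n. {- real n..0})" if "x \<le> 0" for x
    using that real_arch_simple[of "- x"] by (auto simp: minus_le_iff)
  then have "(\<Union>n. {- real n..0}) = {..0}"
    by auto
  then have "emeasure m {..0} = (SUP n. emeasure m {- real n..0})"
    by (subst SUP_emeasure_incseq) (auto simp: sets incseq_def)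
  then have "ennreal d * emeasure m {..0} \<le> I"
    using bound by (simp add: SUP_mult_left_ennreal SUP_least)
  moreover have "I < \<infinity>"
    using assms(2) by (simp add: I_def positively_recurrent_def)
  ultimately have "ennreal d * emeasure m {..0} < \<infinity>"
    by (rule le_less_trans)
  then show ?thesis
    using d by (auto simp: ennreal_mult_less_top)
qed

lemma speed_measure_finite:
  assumes "diffusion P" "positively_recurrent P" "scale_function P S" "speed_measure P S m"
  shows "finite_measure m"
proof
  have sets: "sets m = sets borel"
    using assms(4) by (simp add: speed_measure_def)
  have "emeasure m (space m) = emeasure m ({..0} \<union> {0..})"
    using sets_eq_imp_space_eq[OF sets] by (auto intro!: arg_cong[where f = "emeasure m"])
  also have "\<dots> \<le> emeasure m {..0} + emeasure m {0..}"
    by (intro emeasure_subadditive) (auto simp: sets)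
  also have "\<dots> < \<infinity>"
    using speed_measure_finite_above[OF assms] speed_measure_finite_below[OF assms] by simp
  finally show "emeasure m (space m) \<noteq> \<infinity>" by simp
qed

section \<open>The form domain and the kernel of the generator\<close>

text \<open>The positive and negative parts of \<open>f\<close> are densities of two finite measures
  that agree on all rays, hence agree. So the two parts coincide almost everywhere, which forces
  both to vanish.\<close>

lemma AE_eq_0_if_tail_integrals_eq_0:
  fixes f :: "real \<Rightarrow> real"
  assumes sets: "sets M = sets borel" and f: "integrable M f"
    and zero: "\<And>x. (LINT y:{x<..}|M. f y) = 0"
  shows "AE x in M. f x = 0"
proof -
  have [measurable]: "f \<in> borel_measurable M"
    using f by simp
  have fin: "(\<integral>\<^sup>+x. ennreal (f x) \<partial>M) < \<infinity>" "(\<integral>\<^sup>+x. ennreal (- f x) \<partial>M) < \<infinity>"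
    using f by (auto simp: real_integrable_def less_top)
  have Ioi [measurable]: "{x<..} \<in> sets M" for x
    by (simp add: sets)
  have tails: "emeasure (density M (\<lambda>x. ennreal (f x))) {x<..} =
    emeasure (density M (\<lambda>x. ennreal (- f x))) {x<..}" for x
  proof -
    have int: "integrable M (\<lambda>y. indicator {x<..} y * f y)"
      using integrable_real_mult_indicator[OF Ioi f] by (simp add: mult.commute)
    have "(\<integral>\<^sup>+y. ennreal (indicator {x<..} y * f y) \<partial>M) =
      (\<integral>\<^sup>+y. ennreal (- (indicator {x<..} y * f y)) \<partial>M)"
      using zero[of x] int unfolding real_lebesgue_integral_def[OF int] set_lebesgue_integral_def
        real_scaleR_def real_integrable_def
      by (cases rule: ennreal2_cases[of "\<integral>\<^sup>+y. ennreal (indicator {x<..} y * f y) \<partial>M"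
            "\<integral>\<^sup>+y. ennreal (- (indicator {x<..} y * f y)) \<partial>M"]) auto
    moreover have "ennreal (f y) * indicator {x<..} y = ennreal (indicator {x<..} y * f y)"
      "ennreal (- f y) * indicator {x<..} y = ennreal (- (indicator {x<..} y * f y))" for y
      by (simp_all split: split_indicator)
    ultimately show ?thesis
      by (simp add: emeasure_density)
  qed
  have "density M (\<lambda>x. ennreal (f x)) = density M (\<lambda>x. ennreal (- f x))"
  proof (rule measure_eqI_lessThan)
    fix x :: real
    have "emeasure (density M (\<lambda>x. ennreal (f x))) {x<..} \<le> (\<integral>\<^sup>+x. ennreal (f x) \<partial>M)"
      by (auto simp: emeasure_density intro!: nn_integral_mono split: split_indicator)
    with fin(1) show "emeasure (density M (\<lambda>x. ennreal (f x))) {x<..} < \<infinity>"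
      by (rule le_less_trans[rotated])
  qed (simp_all add: sets tails)
  then have "AE x in M. ennreal (f x) = ennreal (- f x)"
    using fin(1) by (subst (asm) finite_density_unique) auto
  then show ?thesis
    by eventually_elim (metis ennreal_eq_0_iff linorder_le_cases neg_le_0_iff_le order_antisym)
qed

text \<open>Transfers a bound on the infimum to each single \<open>x\<close>: if
  \<open>E x > 0\<close>, every admissible constant is at least \<open>V x / E x\<close>; if
  \<open>E x = 0\<close>, the existence of one already forces \<open>V x = 0\<close>.\<close>

lemma ennreal_le_mult_Inf_iff:
  fixes V E :: "'a \<Rightarrow> real"
  assumes "\<gamma> > 0" and nonneg: "\<And>x. 0 \<le> V x" "\<And>x. 0 \<le> E x"
  shows "Inf {c. \<forall>x\<in>D. ennreal (V x) \<le> c * ennreal (E x)} \<le> ennreal (1 / \<gamma>) \<longleftrightarrow>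
    (\<forall>x\<in>D. \<gamma> * V x \<le> E x)" (is "Inf ?C \<le> _ \<longleftrightarrow> _")
proof
  assume le: "Inf ?C \<le> ennreal (1 / \<gamma>)"
  show "\<forall>x\<in>D. \<gamma> * V x \<le> E x"
  proof
    fix x assume x: "x \<in> D"
    show "\<gamma> * V x \<le> E x"
    proof (cases "E x = 0")
      case True
      \<comment> \<open>The infimum of the empty set is infinity, so finiteness supplies an
        admissible constant.\<close>
      have "Inf ?C < \<infinity>"
        using le by (rule le_less_trans) simp
      then obtain c where "c \<in> ?C"
        by (auto simp: Inf_less_iff)
      with x have "ennreal (V x) \<le> c * ennreal (E x)"
        by simp
      with True have "V x \<le> 0"
        by (simp add: ennreal_eq_0_iff)
      with nonneg(1)[of x] True show ?thesis
        by simp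
    next
      case False
      with nonneg(2)[of x] have E: "0 < E x" by simp
      have "ennreal (V x / E x) \<le> Inf ?C"
      proof (rule Inf_greatest)
        fix c assume "c \<in> ?C"
        with x have "ennreal (V x) \<le> c * ennreal (E x)"
          by simp
        with E nonneg(1)[of x] show "ennreal (V x / E x) \<le> c"
          by (cases c) (auto simp: divide_le_eq ennreal_le_iff simp flip: ennreal_mult)
      qed
      with le have "ennreal (V x / E x) \<le> ennreal (1 / \<gamma>)"
        by (rule order_trans[rotated])
      with E \<open>\<gamma> > 0\<close> show ?thesis
        by (simp add: ennreal_le_iff field_simps)
    qed
  qed
next
  assume gap: "\<forall>x\<in>D. \<gamma> * V x \<le> E x"
  have "V x \<le> 1 / \<gamma> * E x" if "x \<in> D" for x
    using gap that \<open>\<gamma> > 0\<close> by (simp add: field_simps)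
  then have "ennreal (V x) \<le> ennreal (1 / \<gamma>) * ennreal (E x)" if "x \<in> D" for x
    using that \<open>\<gamma> > 0\<close> nonneg(2)[of x] by (simp add: ennreal_leI flip: ennreal_mult)
  then show "Inf ?C \<le> ennreal (1 / \<gamma>)"
    by (intro Inf_lower) auto
qed

section \<open>Scale densities and the form domain\<close>

text \<open>Isolates the only facts about the diffusion that the analysis of the form uses; the
  process itself does not occur again until the theorem.\<close>

locale scale_speed = finite_measure m for m :: "real measure" +
  fixes S :: "real \<Rightarrow> real"
  assumes cont_S: "continuous_on UNIV S" and mono_S: "strict_mono S"
    and sets_m [measurable_cong]: "sets m = sets borel"
    and interval_pos: "a < b \<Longrightarrow> emeasure m {a<..<b} > 0"
begin

lemma space_m [simp]: "space m = UNIV"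
  using sets_eq_imp_space_eq[OF sets_m] by simp

lemma measure_m_pos: "measure m UNIV > 0"
proof -
  have "0 < emeasure m {0<..<1}"
    by (rule interval_pos) simp
  also have "\<dots> \<le> emeasure m UNIV"
    by (intro emeasure_mono) (auto simp: sets_m)
  finally show ?thesis
    by (simp add: emeasure_eq_measure)
qed

lemma emeasure_scale_Icc: "a \<le> b \<Longrightarrow> emeasure (interval_measure S) {a..b} = ennreal (S b - S a)"
  using mono_S cont_S by (intro emeasure_interval_measure_Icc) (auto simp: strict_mono_less_eq)

text \<open>Half-open intervals arise as differences of the closed intervals from
  \<open>u - 1\<close> to \<open>v\<close> and to \<open>u\<close>, so adjacent pieces do not share
  an endpoint.\<close>

lemma scale_density_Ioc:
  assumes "has_scale_density S F f" "u < v"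
  shows "set_integrable (interval_measure S) {u<..v} f"
    and "(LINT x:{u<..v}|interval_measure S. f x) = F v - F u"
proof -
  have D: "set_integrable (interval_measure S) {a..b} f"
    "(LINT x:{a..b}|interval_measure S. f x) = F b - F a" if "a < b" for a b
    using assms(1) that by (auto simp: has_scale_density_def)
  show int: "set_integrable (interval_measure S) {u<..v} f"
    by (rule set_integrable_subset[OF D(1)[OF assms(2)]]) auto
  have "(LINT x:{u - 1..u} \<union> {u<..v}|interval_measure S. f x) =
    (LINT x:{u - 1..u}|interval_measure S. f x) + (LINT x:{u<..v}|interval_measure S. f x)"
    using D(1)[of "u - 1" u] int by (intro set_integral_Un) auto
  moreover have "{u - 1..u} \<union> {u<..v} = {u - 1..v}"
    using assms(2) by auto
  ultimately show "(LINT x:{u<..v}|interval_measure S. f x) = F v - F u"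
    using D(2)[of "u - 1" u] D(2)[of "u - 1" v] assms(2) by simp
qed

text \<open>Local integrability makes each truncation to a bounded interval measurable, and
  \<open>f\<close> is the pointwise limit of the truncations.\<close>

lemma scale_density_measurable:
  assumes "has_scale_density S F f"
  shows "f \<in> borel_measurable borel"
proof (rule borel_measurable_LIMSEQ_real)
  fix x
  show "(\<lambda>n. indicator {- real (Suc n)<..real (Suc n)} x * f x) \<longlonglongrightarrow> f x"
  proof (rule tendsto_eventually)
    have "\<forall>\<^sub>F n in sequentially. \<bar>x\<bar> < real (Suc n)"
      by real_asymp
    then show "\<forall>\<^sub>F n in sequentially. indicator {- real (Suc n)<..real (Suc n)} x * f x = f x"
      by eventually_elim (auto split: split_indicator)
  qed
next
  fix n
  have "set_integrable (interval_measure S) {- real (Suc n)<..real (Suc n)} f"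
    by (rule scale_density_Ioc[OF assms]) simp
  then show "(\<lambda>x. indicator {- real (Suc n)<..real (Suc n)} x * f x) \<in> borel_measurable borel"
    by (auto simp: set_integrable_def dest!: borel_measurable_integrable cong: measurable_cong_sets)
qed

text \<open>A density is only locally integrable, so it is cut off to bounded windows. A ray meets
  such a window in a half-open interval, over which the integral is an increment of a constant, so
  the tail criterion applies.\<close>

lemma scale_density_zero:
  assumes "has_scale_density S (\<lambda>_. k) f"
  shows "AE x in interval_measure S. f x = 0"
proof -
  have "AE x in interval_measure S. indicator {- real (Suc n)<..real (Suc n)} x * f x = 0" for n
  proof (rule AE_eq_0_if_tail_integrals_eq_0)
    let ?I = "{- real (Suc n)<..real (Suc n)}"
    show "integrable (interval_measure S) (\<lambda>x. indicator ?I x * f x)"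
      using scale_density_Ioc(1)[OF assms, of "- real (Suc n)" "real (Suc n)"]
      by (simp add: set_integrable_def)
    fix x
    have "(LINT y:{x<..}|interval_measure S. indicator ?I y * f y) =
      (LINT y:{max x (- real (Suc n))<..real (Suc n)}|interval_measure S. f y)"
      unfolding set_lebesgue_integral_def
      by (intro Bochner_Integration.integral_cong) (auto split: split_indicator)
    also have "\<dots> = 0"
    proof (cases "max x (- real (Suc n)) < real (Suc n)")
      case True
      then show ?thesis
        using scale_density_Ioc(2)[OF assms True] by simp
    next
      case False
      then show ?thesis
        by (simp add: set_lebesgue_integral_def)
    qed
    finally show "(LINT y:{x<..}|interval_measure S. indicator ?I y * f y) = 0" .
  qed simp
  then have "AE x in interval_measure S. \<forall>n. indicator {- real (Suc n)<..real (Suc n)} x * f x = 0"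
    unfolding AE_all_countable by blast
  then show ?thesis
  proof eventually_elim
    case (elim x)
    obtain n where "\<bar>x\<bar> < real n"
      using reals_Archimedean2 by blast
    with spec[OF elim, of n] show ?case
      by (auto simp: indicator_def split: if_splits)
  qed
qed

lemma scale_density_unique:
  assumes "has_scale_density S F f" "has_scale_density S F g"
  shows "AE x in interval_measure S. f x = g x"
proof -
  have "has_scale_density S (\<lambda>_. 0) (\<lambda>x. f x - g x)"
    using assms unfolding has_scale_density_def
    by (auto intro: set_integral_diff simp: set_integral_diff)
  from scale_density_zero[OF this] show ?thesis
    by eventually_elim simp
qed

lemma scale_deriv_AE_eq:
  assumes "has_scale_density S F f"
  shows "has_scale_density S F (scale_deriv S F)"
    and "AE x in interval_measure S. scale_deriv S F x = f x"
proof -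
  show "has_scale_density S F (scale_deriv S F)"
    unfolding scale_deriv_def using someI[of "has_scale_density S F"] assms by blast
  then show "AE x in interval_measure S. scale_deriv S F x = f x"
    using assms by (rule scale_density_unique)
qed

text \<open>Membership refers to the version chosen by \<open>scale_deriv\<close>; almost everywhere
  uniqueness allows it to be checked on any density.\<close>

lemma form_domainI:
  assumes "F \<in> square_integrable m" "has_scale_density S F f"
    and f: "f \<in> square_integrable (interval_measure S)"
  shows "F \<in> form_domain S m"
proof -
  note sd = scale_deriv_AE_eq[OF assms(2)]
  have [measurable]: "scale_deriv S F \<in> borel_measurable (interval_measure S)"
    using scale_density_measurable[OF sd(1)] by (simp cong: measurable_cong_sets)
  have [measurable]: "f \<in> borel_measurable (interval_measure S)"
    using f by (simp add: square_integrable_def)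
  have "integrable (interval_measure S) (\<lambda>x. (scale_deriv S F x)\<^sup>2) \<longleftrightarrow>
    integrable (interval_measure S) (\<lambda>x. (f x)\<^sup>2)"
    using sd(2) by (intro integrable_cong_AE) (auto elim: eventually_mono)
  then show ?thesis
    using assms by (auto simp: form_domain_def square_integrable_def)
qed

lemma form_domainD:
  assumes "F \<in> form_domain S m"
  shows "has_scale_density S F (scale_deriv S F)"
    and "scale_deriv S F \<in> borel_measurable (interval_measure S)"
    and "integrable (interval_measure S) (\<lambda>x. (scale_deriv S F x)\<^sup>2)"
    and "F \<in> borel_measurable m" "integrable m (\<lambda>x. (F x)\<^sup>2)" "integrable m F"
  using assms scale_deriv_AE_eq(1) square_integrable_imp_integrable
  by (auto simp: form_domain_def square_integrable_def)

lemma has_scale_density_const: "has_scale_density S (\<lambda>_. k) (\<lambda>_. 0)"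
  by (simp add: has_scale_density_def set_integrable_def set_lebesgue_integral_def)

lemma const_in_form_domain: "(\<lambda>_. k) \<in> form_domain S m"
  by (rule form_domainI[OF _ has_scale_density_const]) (auto simp: square_integrable_def)

section \<open>The kernel of the generator and its projection\<close>

lemma operator_kernel_eq_constants:
  "operator_kernel (form_generator m (form_domain S m) (dirichlet_form S)) = range (\<lambda>k _. k)"
proof (intro equalityI subsetI)
  fix F assume "F \<in> operator_kernel (form_generator m (form_domain S m) (dirichlet_form S))"
  \<comment> \<open>Taking \<open>h = F\<close> in the defining identity with \<open>g = 0\<close>
    gives zero energy.\<close>
  then have F: "F \<in> form_domain S m" "dirichlet_form S F F = 0"
    by (auto simp: operator_kernel_def form_generator_def)
  note D = form_domainD[OF F(1)]
  have "AE x in interval_measure S. (scale_deriv S F x)\<^sup>2 = 0"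
    using F(2) D(3) by (subst integral_nonneg_eq_0_iff_AE[symmetric])
      (auto simp: dirichlet_form_def power2_eq_square)
  then have "AE x in interval_measure S. scale_deriv S F x = 0"
    by simp
  then have "(LINT x:{u..v}|interval_measure S. scale_deriv S F x) = 0" for u v
    unfolding set_lebesgue_integral_def
    by (intro integral_eq_zero_AE) (auto elim: eventually_mono)
  then have eq: "F u = F v" if "u < v" for u v
    using D(1) that by (simp add: has_scale_density_def)
  have "F = (\<lambda>_. F 0)"
    using eq by (metis linorder_neqE_linordered_idom)
  then show "F \<in> range (\<lambda>k _. k)"
    by blast
next
  fix F :: "real \<Rightarrow> real" assume "F \<in> range (\<lambda>k _. k)"
  then obtain k where k: "F = (\<lambda>_. k)" by blast
  have "AE x in interval_measure S. scale_deriv S F x = 0"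
    unfolding k by (rule scale_deriv_AE_eq[OF has_scale_density_const])
  then have "dirichlet_form S F h = 0" for h
    unfolding dirichlet_form_def by (intro integral_eq_zero_AE) (auto elim: eventually_mono)
  then show "F \<in> operator_kernel (form_generator m (form_domain S m) (dirichlet_form S))"
    using const_in_form_domain[of k] k
    by (simp add: operator_kernel_def form_generator_def square_integrable_def)
qed

text \<open>Orthogonality of \<open>f - c\<close> to all constants says that its integral vanishes,
  which singles out the mean because the total mass is positive. The choice in
  \<open>orth_proj\<close> is therefore unique.\<close>

lemma orth_proj_constants:
  assumes "integrable m f"
  shows "orth_proj m (range (\<lambda>k _. k)) f = (\<lambda>_. mean m f)"
proof -
  have mean: "(\<forall>k. (LINT x|m. (f x - c) * k) = 0) \<longleftrightarrow> c = mean m f" for c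
  proof -
    have "(LINT x|m. (f x - c) * k) = ((LINT x|m. f x) - c * measure m UNIV) * k" for k
      using assms by simp
    moreover have "(LINT x|m. f x) - c * measure m UNIV = 0 \<longleftrightarrow> c = mean m f"
      using measure_m_pos by (auto simp: mean_def field_simps)
    ultimately show ?thesis
      by (metis mult_zero_left mult.right_neutral)
  qed
  have "p \<in> range (\<lambda>k _. k) \<and> (\<forall>k\<in>range (\<lambda>k _. k). (LINT x|m. (f x - p x) * k x) = 0) \<longleftrightarrow>
    p = (\<lambda>_. mean m f)" for p
    using mean by auto
  then show ?thesis
    unfolding orth_proj_def by simp
qed

text \<open>Once the projection is the mean, both sides compare the same variance with the same
  energy, once in the reals and once in \<open>ennreal\<close>.\<close>

lemma spectral_gap_at_least_iff:
  "spectral_gap_at_least m (form_domain S m) (dirichlet_form S) \<gamma> \<longleftrightarrow>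
    \<gamma> > 0 \<and> poincare_const S m \<le> ennreal (1 / \<gamma>)"
proof -
  have proj: "orth_proj m (operator_kernel (form_generator m (form_domain S m) (dirichlet_form S))) F =
    (\<lambda>_. mean m F)" if "F \<in> form_domain S m" for F
    unfolding operator_kernel_eq_constants
    by (rule orth_proj_constants[OF form_domainD(6)[OF that]])
  have nn: "(\<integral>\<^sup>+x. ennreal ((F x - mean m F)\<^sup>2) \<partial>m) = ennreal (LINT x|m. (F x - mean m F)\<^sup>2)"
    "(\<integral>\<^sup>+x. ennreal ((scale_deriv S F x)\<^sup>2) \<partial>interval_measure S) = ennreal (dirichlet_form S F F)"
    if "F \<in> form_domain S m" for F
  proof -
    note D = form_domainD[OF that]
    have "integrable m (\<lambda>x. (F x - mean m F)\<^sup>2)"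
      using D(5,6) by (simp add: power2_diff)
    then show "(\<integral>\<^sup>+x. ennreal ((F x - mean m F)\<^sup>2) \<partial>m) = ennreal (LINT x|m. (F x - mean m F)\<^sup>2)"
      by (rule nn_integral_eq_integral) simp
    show "(\<integral>\<^sup>+x. ennreal ((scale_deriv S F x)\<^sup>2) \<partial>interval_measure S) = ennreal (dirichlet_form S F F)"
      using D(3) by (simp add: nn_integral_eq_integral dirichlet_form_def flip: power2_eq_square)
  qed
  have C: "poincare_const S m = Inf {c. \<forall>F\<in>form_domain S m.
    ennreal (LINT x|m. (F x - mean m F)\<^sup>2) \<le> c * ennreal (dirichlet_form S F F)}"
    unfolding poincare_const_def by (simp add: nn cong: ball_cong)
  show ?thesis
  proof (cases "\<gamma> > 0")
    case True
    show ?thesis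
      unfolding C spectral_gap_at_least_def using True
      by (subst ennreal_le_mult_Inf_iff)
        (auto simp: proj dirichlet_form_def cong: ball_cong)
  qed (simp add: spectral_gap_at_least_def)
qed

section \<open>Positivity of the Poincare constant\<close>

lemma has_scale_density_clamp: "has_scale_density S (\<lambda>x. S (max 0 (min x 1))) (indicator {0..1})"
  unfolding has_scale_density_def
proof (intro allI impI conjI)
  fix u v :: real assume "u < v"
  have eq: "indicator {u..v} x *\<^sub>R indicat_real {0..1} x = (indicator {max u 0..min v 1} x :: real)" for x
    by (auto split: split_indicator)
  show "set_integrable (interval_measure S) {u..v} (indicat_real {0..1})"
    unfolding set_integrable_def eq
    by (cases "max u 0 \<le> min v 1") (auto simp: emeasure_scale_Icc)
  have "(LINT x:{u..v}|interval_measure S. indicat_real {0..1} x) =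
    measure (interval_measure S) {max u 0..min v 1}"
    unfolding set_lebesgue_integral_def eq by simp
  also have "\<dots> = S (max 0 (min v 1)) - S (max 0 (min u 1))"
  proof (cases "max u 0 \<le> min v 1")
    case True
    then have "max 0 (min u 1) = max u 0" "max 0 (min v 1) = min v 1"
      by auto
    then show ?thesis
      using True emeasure_scale_Icc[OF True] mono_S
      by (simp add: measure_def strict_mono_less_eq)
  next
    \<comment> \<open>Now \<open>{u..v}\<close> misses \<open>{0..1}\<close>, so both clamped
      endpoints coincide and the intersection is empty.\<close>
    case False
    then have "max 0 (min u 1) = max 0 (min v 1)"
      using \<open>u < v\<close> by auto
    with False show ?thesis by simp
  qed
  finally show "(LINT x:{u..v}|interval_measure S. indicat_real {0..1} x) =
    S (max 0 (min v 1)) - S (max 0 (min u 1))" .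
qed

lemma clamp_in_form_domain: "(\<lambda>x. S (max 0 (min x 1))) \<in> form_domain S m"
proof (rule form_domainI[OF _ has_scale_density_clamp])
  have [measurable]: "(\<lambda>x. S (max 0 (min x 1))) \<in> borel_measurable borel"
    by (intro borel_measurable_continuous_onI continuous_on_compose2[OF cont_S] continuous_intros) auto
  have "S 0 \<le> S (max 0 (min x 1))" "S (max 0 (min x 1)) \<le> S 1" for x
    using mono_S by (auto simp: strict_mono_less_eq)
  then have "\<bar>S (max 0 (min x 1))\<bar> \<le> max \<bar>S 0\<bar> \<bar>S 1\<bar>" for x
    by (smt (verit))
  then have "\<bar>S (max 0 (min x 1))\<bar>\<^sup>2 \<le> (max \<bar>S 0\<bar> \<bar>S 1\<bar>)\<^sup>2" for x
    by (intro power_mono) auto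
  then have "integrable m (\<lambda>x. (S (max 0 (min x 1)))\<^sup>2)"
    by (intro integrable_const_bound[where B = "(max \<bar>S 0\<bar> \<bar>S 1\<bar>)\<^sup>2"]) auto
  then show "(\<lambda>x. S (max 0 (min x 1))) \<in> square_integrable m"
    by (simp add: square_integrable_def)
  have "integrable (interval_measure S) (\<lambda>x. indicator {0..1::real} x :: real)"
    by (simp add: emeasure_scale_Icc)
  moreover have "(indicator {0..1::real} x :: real)\<^sup>2 = indicator {0..1} x" for x
    by (simp split: split_indicator)
  ultimately show "indicator {0..1} \<in> square_integrable (interval_measure S)"
    by (simp add: square_integrable_def)
qed

text \<open>Open intervals have positive mass, so an almost sure identity holds at some point of
  each of them.\<close>

lemma AE_const_on_interval:
  assumes "AE x in m. f x = c" "a < b"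
  obtains x where "a < x" "x < b" "f x = c"
proof (rule ccontr)
  assume "\<not> thesis"
  with that have "f x \<noteq> c" if "x \<in> {a<..<b}" for x
    using that by auto
  with assms(1) have "AE x in m. x \<notin> {a<..<b}"
    by (auto elim: eventually_mono)
  then have "emeasure m {a<..<b} = 0"
    by (subst (asm) AE_iff_measurable[OF _ refl]) (auto simp: sets_m greaterThanLessThan_def
        greaterThan_def lessThan_def Int_def)
  with interval_pos[OF assms(2)] show False
    by simp
qed

lemma poincare_const_pos: "poincare_const S m > 0"
proof -
  let ?F = "\<lambda>x. S (max 0 (min x 1))"
  note D = form_domainD[OF clamp_in_form_domain]
  define V where "V = (\<integral>\<^sup>+x. ennreal ((?F x - mean m ?F)\<^sup>2) \<partial>m)"
  define E where "E = (\<integral>\<^sup>+x. ennreal ((scale_deriv S ?F x)\<^sup>2) \<partial>interval_measure S)"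
  have [measurable]: "?F \<in> borel_measurable m"
    by (rule D)
  have "V \<noteq> 0"
  proof
    assume "V = 0"
    then have AE: "AE x in m. ?F x = mean m ?F"
      unfolding V_def by (subst (asm) nn_integral_0_iff_AE) auto
    \<comment> \<open>The two intervals lie on either side of \<open>{0..1}\<close>, where the
      clamped function takes the values \<open>S 0\<close> and \<open>S 1\<close>.\<close>
    obtain x where "-1 < x" "x < 0" "?F x = mean m ?F"
      by (rule AE_const_on_interval[OF AE, of "-1" 0]) auto
    moreover obtain y where "1 < y" "y < 2" "?F y = mean m ?F"
      by (rule AE_const_on_interval[OF AE, of 1 2]) auto
    ultimately have "S 0 = S 1"
      by simp
    then show False
      using mono_S by (metis strict_mono_eq zero_neq_one)
  qed
  have "E < \<infinity>"
    using D(3) by (simp add: E_def nn_integral_eq_integral)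
  \<comment> \<open>Adding 1 keeps the denominator nonzero without a proof that the energy
    \<open>E\<close> is positive.\<close>
  have "V / (E + 1) \<le> c" if "V \<le> c * E" for c
  proof -
    have "V \<le> c * (E + 1)"
      using that by (rule order_trans) (intro mult_left_mono, auto)
    then have "V / (E + 1) \<le> c * (E + 1) / (E + 1)"
      by (rule divide_right_mono_ennreal)
    also have "\<dots> = c"
      using \<open>E < \<infinity>\<close> by (simp add: ennreal_mult_divide_eq)
    finally show ?thesis .
  qed
  then have "V / (E + 1) \<le> poincare_const S m"
    unfolding poincare_const_def V_def E_def
    using clamp_in_form_domain by (intro Inf_greatest) auto
  moreover have "V / (E + 1) > 0"
    using \<open>V \<noteq> 0\<close> \<open>E < \<infinity>\<close> by (simp add: ennreal_zero_less_divide zero_less_iff_neq_zero)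
  ultimately show ?thesis
    by (rule less_le_trans[rotated])
qed

text \<open>For a finite Poincare constant \<open>r > 0\<close> the admissible widths are exactly
  those in the interval from 0, excluded, to \<open>1 / r\<close>, included. For an infinite one
  there are none.\<close>

lemma is_spectral_gap_iff:
  "is_spectral_gap m (form_domain S m) (dirichlet_form S) \<gamma> \<longleftrightarrow>
    \<gamma> > 0 \<and> poincare_const S m = ennreal (1 / \<gamma>)"
proof (cases "poincare_const S m")
  case (real r)
  with poincare_const_pos have r: "0 < r"
    by simp
  have "spectral_gap_at_least m (form_domain S m) (dirichlet_form S) \<gamma>' \<longleftrightarrow>
    \<gamma>' > 0 \<and> \<gamma>' \<le> 1 / r" for \<gamma>'
    using r by (auto simp: spectral_gap_at_least_iff real ennreal_le_iff field_simps)
  then have "is_spectral_gap m (form_domain S m) (dirichlet_form S) \<gamma> \<longleftrightarrow> \<gamma> = 1 / r"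
    using r unfolding is_spectral_gap_def by (metis order_antisym order_refl zero_less_divide_1_iff)
  also have "\<dots> \<longleftrightarrow> \<gamma> > 0 \<and> poincare_const S m = ennreal (1 / \<gamma>)"
    using r by (auto simp: real ennreal_inj)
  finally show ?thesis .
next
  case top
  then show ?thesis
    by (simp add: is_spectral_gap_def spectral_gap_at_least_iff top_unique)
qed

end

theorem theorem3p2:
  fixes P :: "real \<Rightarrow> (real \<Rightarrow> real) measure"
    and S :: "real \<Rightarrow> real"
    and m :: "real measure"
  assumes "diffusion P"
    and "positively_recurrent P"
    and "scale_function P S"
    and "speed_measure P S m"
  shows "((\<exists>\<gamma>>0. is_spectral_gap m (form_domain S m) (dirichlet_form S) \<gamma>)
            \<longleftrightarrow> poincare_const S m < \<infinity>) \<and>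
         (\<forall>\<gamma>>0. is_spectral_gap m (form_domain S m) (dirichlet_form S) \<gamma>
            \<longrightarrow> ennreal \<gamma> = 1 / poincare_const S m)"
proof -
  interpret finite_measure m
    by (rule speed_measure_finite[OF assms])
  interpret scale_speed m S
    using assms(3,4) speed_measure_interval_pos[OF assms(1,4)]
    by unfold_locales (auto simp: scale_function_def speed_measure_def)
  show ?thesis
  proof (intro conjI iffI allI impI)
    assume "poincare_const S m < \<infinity>"
    then obtain r where r: "poincare_const S m = ennreal r"
      by (cases "poincare_const S m") auto
    \<comment> \<open>Positivity excludes \<open>r = 0\<close>, where \<open>1 / r\<close> would be
      0 by the convention for real division and thus not a width.\<close>
    with poincare_const_pos have "0 < 1 / r"
      by simp
    moreover have "is_spectral_gap m (form_domain S m) (dirichlet_form S) (1 / r)"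
      using calculation by (simp add: is_spectral_gap_iff r)
    ultimately show "\<exists>\<gamma>>0. is_spectral_gap m (form_domain S m) (dirichlet_form S) \<gamma>"
      by blast
  next
    fix \<gamma> :: real
    assume "\<gamma> > 0" "is_spectral_gap m (form_domain S m) (dirichlet_form S) \<gamma>"
    then have "1 / poincare_const S m = ennreal 1 / ennreal (1 / \<gamma>)"
      by (simp add: is_spectral_gap_iff)
    also have "\<dots> = ennreal \<gamma>"
      using \<open>\<gamma> > 0\<close> by (subst divide_ennreal) auto
    finally show "ennreal \<gamma> = 1 / poincare_const S m" ..
  qed (auto simp: is_spectral_gap_iff)
qed

end
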